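(* Let $\{Y_t\}$ follow the stationary and ergodic INAR(1) model $Y_t=\sum_{i=1}^{Y_{t-1}}U_{t,i}+\varepsilon_t$ described in the context, with true thinning parameter $p\in(0,1)$ and innovation probability generating function (PGF) $g_\varepsilon(\cdot)$, which need not belong to the given family $\{g_\varepsilon(\cdot;\theta):\theta\in\Theta\}$ of PGFs of nonnegative integer-valued random variables, where $\Theta\subset\mathbb R$ is open. Assume that: (a) there is $\theta_A\in\Theta$ such that $(\widehat p_T,\widehat\theta_T)'\to(p,\theta_A)'$ in probability as $T\to\infty$; (b) the nonnegative weight function $w$ satisfies $0<\int_0^1w(u)\,du<\infty$ and $\int_0^1w(u)v^2(u)\,du<\infty$, where $v$ is a measurable function on $[0,1]$; (c) $g_\varepsilon(u;\theta)$ is continuous in $\theta$ for all $u\in[0,1]$. Then, with $S_T$ as defined in the context, as $T\to\infty$, $$\frac{S_T}{T}\ \xrightarrow{\ P\ }\ \int_0^1\Big[g_Y(1+p(u-1))\big(g_\varepsilon(u)-g_\varepsilon(u;\theta_A)\big)\Big]^2w(u)\,du .$$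
   Context: INAR(1) model: $\{Y_t\}$ is a sequence of nonnegative integer-valued random variables with $Y_t=\sum_{i=1}^{Y_{t-1}}U_{t,i}+\varepsilon_t$, where the $U_{t,i}$ are independent with $P(U_{t,i}=1)=p$, $P(U_{t,i}=0)=1-p$, $p\in(0,1)$; $U_{t,1},U_{t,2},\dots$ are independent of $Y_{t-1}$ and $\varepsilon_t$; the $\varepsilon_t$ are i.i.d. nonnegative integer-valued with finite variance and $\varepsilon_t$ is independent of $Y_{t-1}$. The conditional law of $Y_t$ given $\mathcal I_{t-1}=\sigma\{Y_s:s\le t-1\}$ is the convolution of the binomial distribution with parameters $(Y_{t-1},p)$ and the law of $\varepsilon_t$. $\{Y_t\}$ is taken to be the (unique) strictly stationary and ergodic solution. The PGF of a nonnegative integer-valued random variable $X$ is $\mathbb E[u^X]$, $u\in[0,1]$ (with $0^0=1$). $g_Y$ denotes the PGF of the stationary marginal law of $Y_t$, and $g_\varepsilon(\cdot)$ (with one argument) the true PGF of $\varepsilon_t$. Test statistic: given observations $Y_1,\dots,Y_T$ and an estimator $(\widehat p_T,\widehat\theta_T)'$ computed from them (with $\widehat\theta_T\in\Theta$), let $$\widehat g_{T,Y}(u)=\frac1T\sum_{t=1}^Tu^{Y_t},\qquad \widehat g_{T0}(u)=g_\varepsilon(u;\widehat\theta_T)\,\widehat g_{T,Y}(1+\widehat p_T(u-1)),$$ $$S_T=T\int_0^1\big(\widehat g_{T,Y}(u)-\widehat g_{T0}(u)\big)^2w(u)\,du,$$ where $w\ge0$ is a measurable weight function on $[0,1]$.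 *)

theory Defs
  imports "HOL-Probability.Probability"
begin

definition conv_in_prob ::
  "'a measure \<Rightarrow> (nat \<Rightarrow> 'a \<Rightarrow> 'b::metric_space) \<Rightarrow> 'b \<Rightarrow> bool" where
  "conv_in_prob M X c \<longleftrightarrow>
     (\<forall>e>0. (\<lambda>T. measure M {\<omega> \<in> space M. dist (X T \<omega>) c > e}) \<longlonglongrightarrow> 0)"

definition pgf :: "'a measure \<Rightarrow> ('a \<Rightarrow> nat) \<Rightarrow> real \<Rightarrow> real" where
  "pgf M X u = (\<integral>\<omega>. u ^ X \<omega> \<partial>M)"

abbreviation path_space :: "(int \<Rightarrow> nat) measure" where
  "path_space \<equiv> PiM UNIV (\<lambda>_. count_space UNIV)"

definition strictly_stationary :: "'a measure \<Rightarrow> (int \<Rightarrow> 'a \<Rightarrow> nat) \<Rightarrow> bool" where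
  "strictly_stationary M Y \<longleftrightarrow>
     distr M path_space (\<lambda>\<omega> t. Y (t + 1) \<omega>) = distr M path_space (\<lambda>\<omega> t. Y t \<omega>)"

text \<open>Ergodicity of the shift under the law of the process on the two-sided path space.\<close>
definition ergodic_process :: "'a measure \<Rightarrow> (int \<Rightarrow> 'a \<Rightarrow> nat) \<Rightarrow> bool" where
  "ergodic_process M Y \<longleftrightarrow>
     (\<forall>A \<in> sets path_space. (\<lambda>x t. x (t + 1)) -` A = A \<longrightarrow>
        measure M {\<omega> \<in> space M. (\<lambda>t. Y t \<omega>) \<in> A} \<in> {0, 1})"

definition past :: "'a measure \<Rightarrow> (int \<Rightarrow> 'a \<Rightarrow> nat) \<Rightarrow> int \<Rightarrow> 'a measure" where
  "past M Y t = sigma (space M) {Y s -` A \<inter> space M | s A. s \<le> t}"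

text \<open>Independence between different objects is stated for the generated sigma-algebras, since
  \<open>indep_var\<close> requires both random variables to have the same value type.\<close>
locale inar1 = prob_space M
  for M :: "'a measure" and p :: real
    and U :: "int \<Rightarrow> nat \<Rightarrow> 'a \<Rightarrow> nat"
    and \<epsilon> :: "int \<Rightarrow> 'a \<Rightarrow> nat"
    and Y :: "int \<Rightarrow> 'a \<Rightarrow> nat" +
  assumes p: "0 < p" "p < 1"
    and rv_Y: "\<And>t. Y t \<in> measurable M (count_space UNIV)"
    and recursion: "\<And>t. AE \<omega> in M. Y t \<omega> = (\<Sum>i=1..Y (t - 1) \<omega>. U t i \<omega>) + \<epsilon> t \<omega>"
    and indep_U: "indep_vars (\<lambda>_. count_space UNIV) (\<lambda>(t, i). U t i) (UNIV \<times> {1..})"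
    and U_one: "\<And>t i. i \<ge> 1 \<Longrightarrow> prob {\<omega> \<in> space M. U t i \<omega> = 1} = p"
    and U_zero: "\<And>t i. i \<ge> 1 \<Longrightarrow> prob {\<omega> \<in> space M. U t i \<omega> = 0} = 1 - p"
    and indep_U_Y_eps: "\<And>t. indep_set
          (sets (vimage_algebra (space M) (\<lambda>\<omega>. \<lambda>i\<in>{1..}. U t i \<omega>) (PiM {1..} (\<lambda>_. count_space UNIV))))
          (sets (vimage_algebra (space M) (\<lambda>\<omega>. (Y (t - 1) \<omega>, \<epsilon> t \<omega>)) (count_space UNIV)))"
    and indep_eps: "indep_vars (\<lambda>_. count_space UNIV) \<epsilon> UNIV"
    and ident_eps: "\<And>s t. distr M (count_space UNIV) (\<epsilon> s) = distr M (count_space UNIV) (\<epsilon> t)"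
    and mean_eps: "\<And>t. integrable M (\<lambda>\<omega>. real (\<epsilon> t \<omega>))"
    and var_eps: "\<And>t. integrable M (\<lambda>\<omega>. (real (\<epsilon> t \<omega>) - expectation (\<lambda>\<omega>. real (\<epsilon> t \<omega>)))\<^sup>2)"
    and indep_eps_Y: "\<And>t. indep_var (count_space UNIV) (\<epsilon> t) (count_space UNIV) (Y (t - 1))"
    and cond_law: "\<And>t k. AE \<omega> in M.
          real_cond_exp M (past M Y (t - 1)) (indicator {\<omega> \<in> space M. Y t \<omega> = k}) \<omega>
          = (\<Sum>j\<le>k. pmf (binomial_pmf (Y (t - 1) \<omega>) p) j
                     * prob {\<omega>' \<in> space M. \<epsilon> t \<omega>' = k - j})"
    and stationary: "strictly_stationary M Y"
    and ergodic: "ergodic_process M Y"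

definition sample :: "(int \<Rightarrow> 'a \<Rightarrow> nat) \<Rightarrow> nat \<Rightarrow> 'a \<Rightarrow> nat list" where
  "sample Y T \<omega> = map (\<lambda>t. Y (int t) \<omega>) [1..<Suc T]"

definition emp_pgf :: "(int \<Rightarrow> 'a \<Rightarrow> nat) \<Rightarrow> nat \<Rightarrow> 'a \<Rightarrow> real \<Rightarrow> real" where
  "emp_pgf Y T \<omega> u = 1 / real T * (\<Sum>t=1..T. u ^ Y (int t) \<omega>)"

text \<open>The parametric family of innovation laws is \<open>Q\<close>. The estimators are arbitrary functions of
  the list of observations, whose length is the sample size; measurability is automatic because
  there are only countably many such lists.\<close>
definition null_pgf ::
  "(real \<Rightarrow> nat pmf) \<Rightarrow> (nat list \<Rightarrow> real) \<Rightarrow> (nat list \<Rightarrow> real) \<Rightarrow> (int \<Rightarrow> 'a \<Rightarrow> nat)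
    \<Rightarrow> nat \<Rightarrow> 'a \<Rightarrow> real \<Rightarrow> real" where
  "null_pgf Q p_est \<theta>_est Y T \<omega> u =
     pgf (measure_pmf (Q (\<theta>_est (sample Y T \<omega>)))) (\<lambda>n. n) u
     * emp_pgf Y T \<omega> (1 + p_est (sample Y T \<omega>) * (u - 1))"

definition test_stat ::
  "(real \<Rightarrow> nat pmf) \<Rightarrow> (nat list \<Rightarrow> real) \<Rightarrow> (nat list \<Rightarrow> real) \<Rightarrow> (real \<Rightarrow> real)
    \<Rightarrow> (int \<Rightarrow> 'a \<Rightarrow> nat) \<Rightarrow> nat \<Rightarrow> 'a \<Rightarrow> real" where
  "test_stat Q p_est \<theta>_est w Y T \<omega> =
     real T * (\<integral>u. (emp_pgf Y T \<omega> u - null_pgf Q p_est \<theta>_est Y T \<omega> u)\<^sup>2 * w u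
                 \<partial>lebesgue_on {0..1})"

end

theory Submission
  imports Defs
begin

text \<open>
  Conditioning on the past gives
  \<open>E[\<phi>(Y\<^sub>s) u^Y\<^sub>t] = g\<^sub>\<epsilon>(u) E[\<phi>(Y\<^sub>s) (1 + p (u - 1))^Y\<^sub>t\<^sub>-\<^sub>1]\<close> for \<open>s < t\<close>. With \<open>\<phi> = 1\<close> and stationarity this
  is \<open>g\<^sub>Y(u) = g\<^sub>\<epsilon>(u) g\<^sub>Y(1 + p (u - 1))\<close>, which explains the form of the limit. Iterating it shows that
  the covariance of \<open>u^Y\<^sub>s\<close> and \<open>u^Y\<^sub>t\<close> vanishes as \<open>t - s\<close> grows, so the weak law for
  the empirical PGF at each \<open>u\<close> follows from Chebyshev's inequality.
  Since PGFs are monotone and continuous on the unit interval, the convergence is uniform in \<open>u\<close>.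
  On the event that the estimators are close to \<open>(p, \<theta>\<^sub>A)\<close> and the empirical PGF is uniformly close to
  \<open>g\<^sub>Y\<close>, the remaining error \<open>\<integral> |g\<^sub>\<epsilon>(u; \<theta>) - g\<^sub>\<epsilon>(u; \<theta>\<^sub>A)| w(u) du\<close> is small by dominated convergence
  in \<open>\<theta>\<close>.
\<close>

section \<open>Generating functions of counting variables on a probability space\<close>

context prob_space
begin

lemma integrable_power_rv:
  fixes X :: "'a \<Rightarrow> nat" and u :: real
  assumes [measurable]: "X \<in> M \<rightarrow>\<^sub>M count_space UNIV" and "u \<in> {0..1}"
  shows "integrable M (\<lambda>\<omega>. u ^ X \<omega>)"
  by (rule integrable_const_bound[where B = 1]) (use assms(2) in \<open>auto simp: power_le_one\<close>)

lemma pgf_nonneg: "u \<in> {0..1} \<Longrightarrow> 0 \<le> pgf M X u"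
  by (auto simp: pgf_def)

lemma pgf_1: "pgf M X 1 = 1"
  by (simp add: pgf_def prob_space)

lemma pgf_mono:
  assumes "X \<in> M \<rightarrow>\<^sub>M count_space UNIV" "x \<in> {0..1}" "y \<in> {0..1}" "x \<le> y"
  shows "pgf M X x \<le> pgf M X y"
  unfolding pgf_def
  by (rule integral_mono) (use assms in \<open>auto intro!: integrable_power_rv power_mono\<close>)

lemma pgf_le_1:
  assumes "X \<in> M \<rightarrow>\<^sub>M count_space UNIV" "u \<in> {0..1}"
  shows "pgf M X u \<le> 1"
  using pgf_mono[OF assms(1), of u 1] assms(2) by (simp add: pgf_1)

text \<open>The constant 1 dominates every \<open>u ^ X \<omega>\<close>, so limits in
  \<open>u\<close> pass under the expectation. Continuity at the endpoint 1 is what later makes the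
  PGF along iterated thinning tend to 1.\<close>

lemma continuous_on_pgf:
  assumes [measurable]: "X \<in> M \<rightarrow>\<^sub>M count_space UNIV"
  shows "continuous_on {0..1} (pgf M X)"
  unfolding continuous_on_sequentially
proof (intro allI ballI impI)
  fix x :: "nat \<Rightarrow> real" and a :: real
  assume *: "a \<in> {0..1}" "(\<forall>n. x n \<in> {0..1}) \<and> x \<longlonglongrightarrow> a"
  show "(pgf M X \<circ> x) \<longlonglongrightarrow> pgf M X a"
    unfolding comp_def pgf_def
  proof (rule integral_dominated_convergence[where w = "\<lambda>_. 1"])
    show "AE \<omega> in M. (\<lambda>n. x n ^ X \<omega>) \<longlonglongrightarrow> a ^ X \<omega>"
      using * by (auto intro!: tendsto_intros)
    show "AE \<omega> in M. norm (x n ^ X \<omega>) \<le> 1" for n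
      using * by (auto simp: power_le_one)
  qed auto
qed

text \<open>Splitting by the value of \<open>X\<close> turns information about the events
  \<open>X = k\<close>, the form in which the conditional law is given, into information about a
  generating function. The weight \<open>Z\<close> makes room for a function of the past.\<close>

lemma sums_expectation_mult_power:
  fixes X :: "'a \<Rightarrow> nat" and Z :: "'a \<Rightarrow> real"
  assumes [measurable]: "X \<in> M \<rightarrow>\<^sub>M count_space UNIV" and Z: "integrable M Z" and u: "u \<in> {0..1}"
  shows "(\<lambda>k. u ^ k * expectation (\<lambda>\<omega>. Z \<omega> * indicator {\<omega> \<in> space M. X \<omega> = k} \<omega>))
           sums expectation (\<lambda>\<omega>. Z \<omega> * u ^ X \<omega>)"
proof -
  note [measurable] = borel_measurable_integrable[OF Z]
  have int: "integrable M (\<lambda>\<omega>. Z \<omega> * indicator {\<omega> \<in> space M. X \<omega> = k} \<omega>)" for k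
    by (rule integrable_real_mult_indicator[OF _ Z]) measurable
  \<comment> \<open>Only the summand with \<open>k = X \<omega>\<close> can survive, so the partial
    sum is \<open>Z \<omega> * u ^ X \<omega>\<close> cut off at \<open>X \<omega> < n\<close>.
    Hence the majorant \<open>\<bar>Z \<omega>\<bar>\<close> and a sequence that is eventually
    constant in \<open>n\<close>.\<close>
  have part: "(\<Sum>k<n. u ^ k * (Z \<omega> * indicator {\<omega> \<in> space M. X \<omega> = k} \<omega>))
      = (if X \<omega> < n then Z \<omega> * u ^ X \<omega> else 0)" if "\<omega> \<in> space M" for n \<omega>
  proof -
    have "(\<Sum>k<n. u ^ k * (Z \<omega> * indicator {\<omega> \<in> space M. X \<omega> = k} \<omega>))
        = (\<Sum>k<n. if X \<omega> = k then Z \<omega> * u ^ k else 0)"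
      using that by (intro sum.cong) auto
    also have "\<dots> = (if X \<omega> < n then Z \<omega> * u ^ X \<omega> else 0)"
      by (simp add: sum.delta)
    finally show ?thesis .
  qed
  have "(\<lambda>n. expectation (\<lambda>\<omega>. \<Sum>k<n. u ^ k * (Z \<omega> * indicator {\<omega> \<in> space M. X \<omega> = k} \<omega>)))
      \<longlonglongrightarrow> expectation (\<lambda>\<omega>. Z \<omega> * u ^ X \<omega>)"
  proof (rule integral_dominated_convergence[where w = "\<lambda>\<omega>. \<bar>Z \<omega>\<bar>"])
    show "integrable M (\<lambda>\<omega>. \<bar>Z \<omega>\<bar>)" using Z by simp
    show "AE \<omega> in M. norm (\<Sum>k<n. u ^ k * (Z \<omega> * indicator {\<omega> \<in> space M. X \<omega> = k} \<omega>)) \<le> \<bar>Z \<omega>\<bar>" for n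
      using u by (intro AE_I2) (auto simp: part abs_mult power_le_one mult_left_le)
    show "AE \<omega> in M. (\<lambda>n. \<Sum>k<n. u ^ k * (Z \<omega> * indicator {\<omega> \<in> space M. X \<omega> = k} \<omega>))
        \<longlonglongrightarrow> Z \<omega> * u ^ X \<omega>"
    proof (rule AE_I2)
      fix \<omega> assume \<omega>: "\<omega> \<in> space M"
      show "(\<lambda>n. \<Sum>k<n. u ^ k * (Z \<omega> * indicator {\<omega> \<in> space M. X \<omega> = k} \<omega>)) \<longlonglongrightarrow> Z \<omega> * u ^ X \<omega>"
        by (rule tendsto_eventually, rule eventually_sequentiallyI[of "Suc (X \<omega>)"])
           (simp add: part[OF \<omega>])
    qed
  qed auto
  also have "(\<lambda>n. expectation (\<lambda>\<omega>. \<Sum>k<n. u ^ k * (Z \<omega> * indicator {\<omega> \<in> space M. X \<omega> = k} \<omega>)))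
      = (\<lambda>n. \<Sum>k<n. u ^ k * expectation (\<lambda>\<omega>. Z \<omega> * indicator {\<omega> \<in> space M. X \<omega> = k} \<omega>))"
    using int by (subst Bochner_Integration.integral_sum) auto
  finally show ?thesis unfolding sums_def .
qed

lemma pgf_sums:
  assumes [measurable]: "X \<in> M \<rightarrow>\<^sub>M count_space UNIV" and u: "u \<in> {0..1}"
  shows "(\<lambda>k. u ^ k * prob {\<omega> \<in> space M. X \<omega> = k}) sums pgf M X u"
  using sums_expectation_mult_power[OF assms(1) integrable_const[of "1::real"] u]
  by (simp add: pgf_def)

end

section \<open>Binomial thinning and bounds on the empirical PGF\<close>

lemma binomial_pgf_sums:
  fixes u :: real
  assumes "0 < p" "p < 1"
  shows "(\<lambda>j. u ^ j * pmf (binomial_pmf n p) j) sums (1 + p * (u - 1)) ^ n"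
proof -
  \<comment> \<open>The series terminates, since the binomial coefficients vanish for
    \<open>j > n\<close>; the form as an infinite series prepares the Cauchy product with the
    innovation series.\<close>
  have "(\<lambda>j. u ^ j * pmf (binomial_pmf n p) j) sums (\<Sum>j\<le>n. u ^ j * pmf (binomial_pmf n p) j)"
    using assms by (intro sums_finite) (auto simp: binomial_eq_0)
  also have "(\<Sum>j\<le>n. u ^ j * pmf (binomial_pmf n p) j)
      = (\<Sum>j\<le>n. of_nat (n choose j) * (p * u) ^ j * (1 - p) ^ (n - j))"
    using assms by (intro sum.cong) (auto simp: power_mult_distrib)
  also have "\<dots> = (p * u + (1 - p)) ^ n"
    by (rule binomial_ring[symmetric])
  also have "p * u + (1 - p) = 1 + p * (u - 1)" by (simp add: algebra_simps)
  finally show ?thesis .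
qed

lemma thinned_arg_in_unit:
  fixes p u :: real
  assumes "0 \<le> p" "p \<le> 1" "u \<in> {0..1}"
  shows "1 + p * (u - 1) \<in> {0..1}"
proof -
  have "p * (1 - u) \<le> 1 * 1" "0 \<le> p * (1 - u)" using assms by (intro mult_mono mult_nonneg_nonneg; simp)+
  then show ?thesis by (simp add: algebra_simps)
qed

lemma emp_pgf_nonneg: "u \<in> {0..1} \<Longrightarrow> 0 \<le> emp_pgf Y T \<omega> u"
  by (auto simp: emp_pgf_def intro!: divide_nonneg_nonneg sum_nonneg)

lemma emp_pgf_mono:
  assumes "0 \<le> x" "x \<le> y"
  shows "emp_pgf Y T \<omega> x \<le> emp_pgf Y T \<omega> y"
  unfolding emp_pgf_def using assms by (intro mult_left_mono sum_mono power_mono) auto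

lemma emp_pgf_le_1:
  assumes "u \<in> {0..1}"
  shows "emp_pgf Y T \<omega> u \<le> 1"
proof -
  have "emp_pgf Y T \<omega> u \<le> emp_pgf Y T \<omega> 1" using assms by (intro emp_pgf_mono) auto
  \<comment> \<open>For \<open>T = 0\<close> the convention \<open>1 / 0 = 0\<close> makes the value
    0, hence an inequality and not an equality.\<close>
  also have "\<dots> \<le> 1" by (simp add: emp_pgf_def)
  finally show ?thesis .
qed

lemma continuous_on_emp_pgf: "continuous_on A (emp_pgf Y T \<omega>)"
  unfolding emp_pgf_def by (intro continuous_intros)

section \<open>Marginal laws and the past of the INAR(1) process\<close>

context inar1
begin

declare rv_Y [measurable]

lemma rv_eps [measurable]: "\<epsilon> t \<in> M \<rightarrow>\<^sub>M count_space UNIV"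
  using indep_eps by (auto simp: indep_vars_def)

lemma pgf_eps_eq: "pgf M (\<epsilon> t) u = pgf M (\<epsilon> 0) u"
proof -
  have "pgf M (\<epsilon> t) u = (\<integral>n. u ^ n \<partial>distr M (count_space UNIV) (\<epsilon> t))" for t
    unfolding pgf_def by (subst integral_distr) auto
  then show ?thesis using ident_eps[of t 0] by simp
qed

lemma distr_Y_eq: "distr M (count_space UNIV) (Y (int n)) = distr M (count_space UNIV) (Y 0)"
proof (induction n)
  case (Suc n)
  \<comment> \<open>Coordinate \<open>n\<close> of the shifted path is the process at time
    \<open>n + 1\<close>, so shift invariance of the path law projects to the marginals.\<close>
  have "distr M (count_space UNIV) (Y (int n + 1))
      = distr (distr M path_space (\<lambda>\<omega> t. Y (t + 1) \<omega>)) (count_space UNIV) (\<lambda>x. x (int n))"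
    by (subst distr_distr) (auto simp: comp_def intro!: measurable_PiM_single')
  also have "\<dots> = distr (distr M path_space (\<lambda>\<omega> t. Y t \<omega>)) (count_space UNIV) (\<lambda>x. x (int n))"
    using stationary by (simp add: strictly_stationary_def)
  also have "\<dots> = distr M (count_space UNIV) (Y (int n))"
    by (subst distr_distr) (auto simp: comp_def intro!: measurable_PiM_single')
  finally show ?case using Suc.IH by (simp add: add.commute)
qed simp

lemma pgf_Y_eq: "pgf M (Y (int n)) u = pgf M (Y 0) u"
proof -
  have "pgf M (Y t) u = (\<integral>n. u ^ n \<partial>distr M (count_space UNIV) (Y t))" for t
    unfolding pgf_def by (subst integral_distr) auto
  then show ?thesis using distr_Y_eq[of n] by simp
qed

lemma
  shows space_past: "space (past M Y t) = space M"
    and sets_past: "sets (past M Y t) = sigma_sets (space M) {Y s -` A \<inter> space M | s A. s \<le> t}"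
  unfolding past_def by (intro space_measure_of sets_measure_of; blast)+

lemma subalgebra_past: "subalgebra M (past M Y t)"
  unfolding subalgebra_def space_past sets_past
  by (auto intro!: sets.sigma_sets_subset measurable_sets[OF rv_Y])

lemma measurable_past: "s \<le> t \<Longrightarrow> Y s \<in> past M Y t \<rightarrow>\<^sub>M count_space UNIV"
  by (rule measurableI) (auto simp: space_past sets_past intro!: sigma_sets.Basic)

section \<open>Conditioning on the past and decay of covariances\<close>

text \<open>The transition law is a convolution, so its PGF is a product, obtained here as the
  Cauchy product of the binomial series and the innovation series.\<close>

lemma transition_pgf_sums:
  assumes u: "u \<in> {0..1}"
  shows "(\<lambda>k. u ^ k * (\<Sum>j\<le>k. pmf (binomial_pmf y p) j * prob {\<omega> \<in> space M. \<epsilon> t \<omega> = k - j}))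
           sums ((1 + p * (u - 1)) ^ y * pgf M (\<epsilon> 0) u)"
proof -
  define a where "a j = u ^ j * pmf (binomial_pmf y p) j" for j
  define b where "b j = u ^ j * prob {\<omega> \<in> space M. \<epsilon> t \<omega> = j}" for j
  have a: "a sums (1 + p * (u - 1)) ^ y"
    unfolding a_def by (rule binomial_pgf_sums[OF p])
  have b: "b sums pgf M (\<epsilon> 0) u"
    unfolding b_def pgf_eps_eq[of t, symmetric] by (rule pgf_sums[OF rv_eps u])
  \<comment> \<open>Both series have nonnegative terms, so they converge absolutely, as the Cauchy
    product requires.\<close>
  have norm: "norm (a j) = a j" "norm (b j) = b j" for j
    using u by (auto simp: a_def b_def simp del: pmf_binomial)
  have "(\<lambda>k. \<Sum>j\<le>k. a j * b (k - j)) sums ((\<Sum>k. a k) * (\<Sum>k. b k))"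
    using a b by (intro Cauchy_product_sums) (simp_all only: norm sums_iff)
  moreover have "(\<Sum>j\<le>k. a j * b (k - j))
      = u ^ k * (\<Sum>j\<le>k. pmf (binomial_pmf y p) j * prob {\<omega> \<in> space M. \<epsilon> t \<omega> = k - j})" for k
    unfolding sum_distrib_left
  proof (rule sum.cong)
    fix j assume "j \<in> {..k}"
    then have "u ^ k = u ^ j * u ^ (k - j)" by (simp flip: power_add)
    then show "a j * b (k - j)
        = u ^ k * (pmf (binomial_pmf y p) j * prob {\<omega> \<in> space M. \<epsilon> t \<omega> = k - j})"
      unfolding a_def b_def by simp
  qed simp
  ultimately show ?thesis
    using sums_unique[OF a] sums_unique[OF b] by simp
qed

text \<open>The factor \<open>\<phi> (Y s \<omega>)\<close> is known at time \<open>t - 1\<close>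
  and comes out of the conditional expectation; the transition PGF then splits off the innovation
  factor, which is constant in \<open>\<omega>\<close>. Keeping a general bounded
  \<open>\<phi>\<close> serves both the iteration over several steps and the mixed moments.\<close>

lemma expectation_one_step:
  fixes \<phi> :: "nat \<Rightarrow> real"
  assumes s: "s \<le> t - 1" and \<phi>: "\<And>n. \<bar>\<phi> n\<bar> \<le> 1" and u: "u \<in> {0..1}"
  shows "expectation (\<lambda>\<omega>. \<phi> (Y s \<omega>) * u ^ Y t \<omega>)
       = pgf M (\<epsilon> 0) u * expectation (\<lambda>\<omega>. \<phi> (Y s \<omega>) * (1 + p * (u - 1)) ^ Y (t - 1) \<omega>)"
proof -
  interpret past: finite_measure_subalgebra M "past M Y (t - 1)"
    by standard (rule subalgebra_past)
  \<comment> \<open>\<open>K k y\<close> is the transition probability from \<open>y\<close> to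
    \<open>k\<close>, and \<open>G y\<close> is the PGF of that transition law at
    \<open>u\<close>.\<close>
  define K where
    "K k y = (\<Sum>j\<le>k. pmf (binomial_pmf y p) j * prob {\<omega> \<in> space M. \<epsilon> t \<omega> = k - j})" for k y
  define G where "G y = (1 + p * (u - 1)) ^ y * pgf M (\<epsilon> 0) u" for y
  have K: "(\<lambda>k. u ^ k * K k y) sums G y" for y
    unfolding K_def G_def by (rule transition_pgf_sums[OF u])
  have K_nonneg: "0 \<le> K k y" for k y
    unfolding K_def by (intro sum_nonneg mult_nonneg_nonneg) auto
  have q: "1 + p * (u - 1) \<in> {0..1}"
    using p u by (intro thinned_arg_in_unit) auto
  have G_le: "G y \<le> 1" for y
    unfolding G_def using q pgf_le_1[OF rv_eps u] pgf_nonneg[OF u]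
    by (intro mult_le_one power_le_one) auto
  \<comment> \<open>Nonnegative terms keep every partial sum below the full sum \<open>G y\<close>.
    This supplies the constant majorant for interchanging sum and expectation below.\<close>
  have part_le: "(\<Sum>k<n. u ^ k * K k y) \<le> 1" and part_nonneg: "0 \<le> (\<Sum>k<n. u ^ k * K k y)" for n y
  proof -
    have "(\<Sum>k<n. u ^ k * K k y) \<le> G y"
      using sum_le_suminf[OF sums_summable[OF K], of "{..<n}" y] sums_unique[OF K, of y] u K_nonneg
      by auto
    with G_le[of y] show "(\<Sum>k<n. u ^ k * K k y) \<le> 1" by simp
    show "0 \<le> (\<Sum>k<n. u ^ k * K k y)"
      using u K_nonneg by (intro sum_nonneg mult_nonneg_nonneg) auto
  qed
  have K_le: "\<bar>K k y\<bar> \<le> 1" for k y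
  proof -
    \<comment> \<open>At argument 1 the transition PGF says that the probabilities
      \<open>K k y\<close> sum to 1 over \<open>k\<close>.\<close>
    have "(\<lambda>k. 1 ^ k * K k y) sums ((1 + p * (1 - 1)) ^ y * pgf M (\<epsilon> 0) 1)"
      unfolding K_def by (rule transition_pgf_sums) auto
    then have "(\<lambda>k. K k y) sums 1" by (simp add: pgf_1)
    then have "K k y \<le> 1"
      using sum_le_suminf[of "\<lambda>k. K k y" "{k}"] K_nonneg by (auto simp: sums_iff)
    then show ?thesis using K_nonneg[of k y] by simp
  qed
  have int: "integrable M (\<lambda>\<omega>. \<phi> (Y s \<omega>))"
    by (rule integrable_const_bound[where B = 1]) (use \<phi> in auto)
  have int_K: "integrable M (\<lambda>\<omega>. \<phi> (Y s \<omega>) * K k (Y (t - 1) \<omega>))" for k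
  proof (rule integrable_const_bound[where B = 1])
    show "AE \<omega> in M. norm (\<phi> (Y s \<omega>) * K k (Y (t - 1) \<omega>)) \<le> 1"
      using \<phi> K_le by (auto simp: abs_mult intro!: mult_le_one)
  qed measurable
  \<comment> \<open>Since \<open>s \<le> t - 1\<close>, \<open>Y s\<close> is measurable for the
    past, so the indicator may be replaced by its conditional expectation, which
    \<open>cond_law\<close> identifies with \<open>K k (Y (t - 1) \<omega>)\<close>.\<close>
  have cond: "expectation (\<lambda>\<omega>. \<phi> (Y s \<omega>) * indicator {\<omega> \<in> space M. Y t \<omega> = k} \<omega>)
      = expectation (\<lambda>\<omega>. \<phi> (Y s \<omega>) * K k (Y (t - 1) \<omega>))" for k
  proof -
    have "expectation (\<lambda>\<omega>. \<phi> (Y s \<omega>) * indicator {\<omega> \<in> space M. Y t \<omega> = k} \<omega>)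
        = expectation (\<lambda>\<omega>. \<phi> (Y s \<omega>) * real_cond_exp M (past M Y (t - 1))
            (indicator {\<omega> \<in> space M. Y t \<omega> = k}) \<omega>)"
    proof (rule past.real_cond_exp_intg(2)[symmetric])
      show "integrable M (\<lambda>\<omega>. \<phi> (Y s \<omega>) * indicator {\<omega> \<in> space M. Y t \<omega> = k} \<omega>)"
        by (rule integrable_real_mult_indicator[OF _ int]) measurable
      show "(\<lambda>\<omega>. \<phi> (Y s \<omega>)) \<in> borel_measurable (past M Y (t - 1))"
        by (rule measurable_compose[OF measurable_past[OF s]]) simp
    qed measurable
    also have "\<dots> = expectation (\<lambda>\<omega>. \<phi> (Y s \<omega>) * K k (Y (t - 1) \<omega>))"
    proof (rule integral_cong_AE)
      show "(\<lambda>\<omega>. \<phi> (Y s \<omega>) * real_cond_exp M (past M Y (t - 1))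
          (indicator {\<omega> \<in> space M. Y t \<omega> = k}) \<omega>) \<in> borel_measurable M"
        by measurable
      show "AE \<omega> in M. \<phi> (Y s \<omega>) * real_cond_exp M (past M Y (t - 1))
          (indicator {\<omega> \<in> space M. Y t \<omega> = k}) \<omega> = \<phi> (Y s \<omega>) * K k (Y (t - 1) \<omega>)"
        using cond_law[of t k] unfolding K_def by eventually_elim simp
    qed (use int_K in auto)
    finally show ?thesis .
  qed
  have "(\<lambda>n. expectation (\<lambda>\<omega>. \<Sum>k<n. u ^ k * (\<phi> (Y s \<omega>) * K k (Y (t - 1) \<omega>))))
      \<longlonglongrightarrow> expectation (\<lambda>\<omega>. \<phi> (Y s \<omega>) * G (Y (t - 1) \<omega>))"
  proof (rule integral_dominated_convergence[where w = "\<lambda>_. 1"])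
    have eq: "(\<Sum>k<n. u ^ k * (\<phi> (Y s \<omega>) * K k (Y (t - 1) \<omega>)))
        = \<phi> (Y s \<omega>) * (\<Sum>k<n. u ^ k * K k (Y (t - 1) \<omega>))" for n \<omega>
      by (simp add: sum_distrib_left mult.left_commute)
    show "AE \<omega> in M. norm (\<Sum>k<n. u ^ k * (\<phi> (Y s \<omega>) * K k (Y (t - 1) \<omega>))) \<le> 1" for n
      unfolding eq using \<phi> part_le part_nonneg by (auto simp: abs_mult intro!: mult_le_one)
    show "AE \<omega> in M. (\<lambda>n. \<Sum>k<n. u ^ k * (\<phi> (Y s \<omega>) * K k (Y (t - 1) \<omega>)))
        \<longlonglongrightarrow> \<phi> (Y s \<omega>) * G (Y (t - 1) \<omega>)"
      unfolding eq using K by (auto simp: sums_def intro!: tendsto_mult_left)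
  qed auto
  also have "(\<lambda>n. expectation (\<lambda>\<omega>. \<Sum>k<n. u ^ k * (\<phi> (Y s \<omega>) * K k (Y (t - 1) \<omega>))))
      = (\<lambda>n. \<Sum>k<n. u ^ k * expectation (\<lambda>\<omega>. \<phi> (Y s \<omega>) * indicator {\<omega> \<in> space M. Y t \<omega> = k} \<omega>))"
    unfolding cond using int_K by (subst Bochner_Integration.integral_sum) auto
  finally have "(\<lambda>k. u ^ k * expectation (\<lambda>\<omega>. \<phi> (Y s \<omega>) * indicator {\<omega> \<in> space M. Y t \<omega> = k} \<omega>))
      sums expectation (\<lambda>\<omega>. \<phi> (Y s \<omega>) * G (Y (t - 1) \<omega>))"
    unfolding sums_def .
  \<comment> \<open>One series has two sums, one from splitting by the value of \<open>Y t\<close>,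
    the other from the transition PGF; uniqueness equates them.\<close>
  from sums_unique2[OF sums_expectation_mult_power[OF rv_Y int u] this]
  have "expectation (\<lambda>\<omega>. \<phi> (Y s \<omega>) * u ^ Y t \<omega>)
      = expectation (\<lambda>\<omega>. (\<phi> (Y s \<omega>) * (1 + p * (u - 1)) ^ Y (t - 1) \<omega>) * pgf M (\<epsilon> 0) u)"
    by (simp add: G_def mult.assoc)
  then show ?thesis by simp
qed

lemma pgf_Y_fixed_point:
  assumes "u \<in> {0..1}"
  shows "pgf M (Y 0) u = pgf M (\<epsilon> 0) u * pgf M (Y 0) (1 + p * (u - 1))"
  using expectation_one_step[of 0 1 "\<lambda>_. 1" u] assms pgf_Y_eq[of 1 u] by (simp add: pgf_def)

text \<open>Thinning acts on the argument as an affine contraction with fixed point 1 and factor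
  \<open>p\<close>, so its \<open>h\<close>-th iterate is \<open>1 + p ^ h * (u - 1)\<close>. The
  accumulated innovation factors form \<open>c\<close>; what matters is that \<open>c\<close> is
  chosen before \<open>\<phi>\<close> and \<open>s\<close>.\<close>

lemma expectation_multi_step:
  assumes "u \<in> {0..1}"
  shows "\<exists>c. \<forall>\<phi> s. (\<forall>n. \<bar>\<phi> n\<bar> \<le> 1) \<longrightarrow>
      expectation (\<lambda>\<omega>. \<phi> (Y s \<omega>) * u ^ Y (s + int h) \<omega>)
    = c * expectation (\<lambda>\<omega>. \<phi> (Y s \<omega>) * (1 + p ^ h * (u - 1)) ^ Y s \<omega>)"
  using assms
proof (induction h arbitrary: u)
  case 0
  show ?case by (intro exI[of _ 1]) simp
next
  case (Suc h)
  have q: "1 + p * (u - 1) \<in> {0..1}"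
    using p Suc.prems by (intro thinned_arg_in_unit) auto
  from Suc.IH[OF q] obtain c where c: "\<And>\<phi> s. (\<forall>n. \<bar>\<phi> n\<bar> \<le> 1) \<Longrightarrow>
      expectation (\<lambda>\<omega>. \<phi> (Y s \<omega>) * (1 + p * (u - 1)) ^ Y (s + int h) \<omega>)
    = c * expectation (\<lambda>\<omega>. \<phi> (Y s \<omega>) * (1 + p ^ h * (p * (u - 1))) ^ Y s \<omega>)"
    by auto
  show ?case
  proof (intro exI[of _ "pgf M (\<epsilon> 0) u * c"] allI impI)
    fix \<phi> :: "nat \<Rightarrow> real" and s assume \<phi>: "\<forall>n. \<bar>\<phi> n\<bar> \<le> 1"
    have "expectation (\<lambda>\<omega>. \<phi> (Y s \<omega>) * u ^ Y (s + int (Suc h)) \<omega>)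
        = pgf M (\<epsilon> 0) u * expectation (\<lambda>\<omega>. \<phi> (Y s \<omega>) * (1 + p * (u - 1)) ^ Y (s + int h) \<omega>)"
      using expectation_one_step[of s "s + int (Suc h)" \<phi> u] \<phi> Suc.prems by (simp add: add.assoc)
    then show "expectation (\<lambda>\<omega>. \<phi> (Y s \<omega>) * u ^ Y (s + int (Suc h)) \<omega>)
        = pgf M (\<epsilon> 0) u * c * expectation (\<lambda>\<omega>. \<phi> (Y s \<omega>) * (1 + p ^ Suc h * (u - 1)) ^ Y s \<omega>)"
      by (simp add: c[OF \<phi>] mult.assoc mult.left_commute[of p])
  qed
qed

text \<open>Only the law of \<open>Y\<^sub>s\<close> and the lag enter, so the constant \<open>c\<^sub>h\<close> of the multi-step formula
  can be eliminated: \<open>\<phi> = 1\<close> gives \<open>g\<^sub>Y(u) = c\<^sub>h g\<^sub>Y(1 - p\<^sup>h (1 - u))\<close>, hence \<open>c\<^sub>h \<rightarrow> g\<^sub>Y(u)\<close>.\<close>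
lemma product_moment_limit:
  assumes u: "u \<in> {0..1}"
  obtains m where "m \<longlonglongrightarrow> (pgf M (Y 0) u)\<^sup>2"
    and "\<And>s h. expectation (\<lambda>\<omega>. u ^ Y (int s) \<omega> * u ^ Y (int s + int h) \<omega>) = m h"
proof -
  define g where "g = pgf M (Y 0)"
  define q where "q h = 1 + p ^ h * (u - 1)" for h
  obtain c where c: "\<And>h \<phi> s. (\<forall>n. \<bar>\<phi> n\<bar> \<le> 1) \<Longrightarrow>
      expectation (\<lambda>\<omega>. \<phi> (Y s \<omega>) * u ^ Y (s + int h) \<omega>)
    = c h * expectation (\<lambda>\<omega>. \<phi> (Y s \<omega>) * q h ^ Y s \<omega>)"
    using expectation_multi_step[OF u] unfolding q_def by metis
  have "(\<lambda>h. p ^ h) \<longlonglongrightarrow> 0" using p by (intro LIMSEQ_power_zero) simp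
  then have "q \<longlonglongrightarrow> 1 + 0 * (u - 1)" unfolding q_def by (intro tendsto_add tendsto_mult tendsto_const)
  then have q: "q \<longlonglongrightarrow> 1" by simp
  have q_in: "q h \<in> {0..1}" for h
    unfolding q_def using p u by (intro thinned_arg_in_unit) (auto simp: power_le_one)
  have uq_in: "u * q h \<in> {0..1}" for h
    using q_in[of h] u by (auto simp: mult_le_one)
  have cont: "continuous_on {0..1} g" unfolding g_def by (rule continuous_on_pgf) simp
  have "(\<lambda>h. g (q h)) \<longlonglongrightarrow> g 1"
    by (rule continuous_on_tendsto_compose[OF cont q]) (use q_in in auto)
  then have gq: "(\<lambda>h. g (q h)) \<longlonglongrightarrow> 1" by (simp add: g_def pgf_1)
  have c_g: "g u = c h * g (q h)" for h
    using c[of "\<lambda>_. 1" 0 h] pgf_Y_eq[of h u] by (simp add: g_def pgf_def)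
  have "(\<lambda>h. g u / g (q h)) \<longlonglongrightarrow> g u / 1" by (intro tendsto_divide gq tendsto_const) simp
  \<comment> \<open>Dividing by \<open>g (q h)\<close> is justified only where it is nonzero, hence
    from some lag on.\<close>
  moreover have "eventually (\<lambda>h. g u / g (q h) = c h) sequentially"
    using order_tendstoD(1)[OF gq zero_less_one]
  proof eventually_elim
    case (elim h)
    then show ?case using c_g[of h] by (simp add: divide_eq_eq)
  qed
  ultimately have "c \<longlonglongrightarrow> g u / 1" by (rule Lim_transform_eventually)
  moreover have "(\<lambda>h. g (u * q h)) \<longlonglongrightarrow> g (u * 1)"
    by (rule continuous_on_tendsto_compose[OF cont tendsto_mult[OF tendsto_const q]])
       (use uq_in u in auto)
  ultimately have "(\<lambda>h. c h * g (u * q h)) \<longlonglongrightarrow> g u / 1 * g (u * 1)"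
    by (rule tendsto_mult)
  moreover have "expectation (\<lambda>\<omega>. u ^ Y (int s) \<omega> * u ^ Y (int s + int h) \<omega>) = c h * g (u * q h)" for s h
  proof -
    \<comment> \<open>With the test function \<open>\<lambda>n. u ^ n\<close> the two powers at time
      \<open>s\<close> merge into one power of \<open>u * q h\<close>.\<close>
    have "expectation (\<lambda>\<omega>. u ^ Y (int s) \<omega> * u ^ Y (int s + int h) \<omega>)
        = c h * pgf M (Y (int s)) (u * q h)"
      using c[of "\<lambda>n. u ^ n" "int s" h] u by (simp add: power_le_one pgf_def power_mult_distrib)
    then show ?thesis by (simp add: pgf_Y_eq g_def)
  qed
  ultimately show thesis
    by (intro that[of "\<lambda>h. c h * g (u * q h)"]) (auto simp: g_def power2_eq_square)
qed

section \<open>Weak law for the empirical PGF at a fixed argument\<close>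

text \<open>The covariances depend only on the lag and vanish as it grows. In the mean square of the
  centred average, pairs within a fixed lag contribute order \<open>1 / T\<close> and all other
  pairs an arbitrarily small amount.\<close>

lemma emp_pgf_conv_in_prob:
  assumes u: "u \<in> {0..1}"
  shows "conv_in_prob M (\<lambda>T \<omega>. emp_pgf Y T \<omega> u) (pgf M (Y 0) u)"
proof -
  define g where "g = pgf M (Y 0) u"
  define X where "X t \<omega> = u ^ Y (int t) \<omega> - g" for t :: nat and \<omega>
  have g01: "0 \<le> g" "g \<le> 1" unfolding g_def using u by (auto intro!: pgf_nonneg pgf_le_1)
  have rvX [measurable]: "X t \<in> borel_measurable M" for t unfolding X_def by measurable
  have pow01: "0 \<le> u ^ n \<and> u ^ n \<le> 1" for n using u by (auto simp: power_le_one)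
  have X_le: "\<bar>X t \<omega>\<bar> \<le> 1" for t \<omega>
    unfolding X_def using pow01[of "Y (int t) \<omega>"] g01 by linarith
  have int_XX: "integrable M (\<lambda>\<omega>. X s \<omega> * X t \<omega>)" for s t
    by (rule integrable_const_bound[where B = 1]) (auto simp: abs_mult X_le intro!: mult_le_one)
  obtain m where m: "m \<longlonglongrightarrow> g\<^sup>2"
    and prod: "\<And>s h. expectation (\<lambda>\<omega>. u ^ Y (int s) \<omega> * u ^ Y (int s + int h) \<omega>) = m h"
    using product_moment_limit[OF u] unfolding g_def by metis
  have EX: "expectation (\<lambda>\<omega>. X s \<omega> * X (s + h) \<omega>) = m h - g\<^sup>2" for s h
  proof -
    note int = integrable_power_rv[OF rv_Y u]
    have int2: "integrable M (\<lambda>\<omega>. u ^ Y (int s) \<omega> * u ^ Y (int s + int h) \<omega>)"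
      by (rule integrable_const_bound[where B = 1]) (use u in \<open>auto simp: abs_mult power_le_one intro!: mult_le_one\<close>)
    have E: "expectation (\<lambda>\<omega>. u ^ Y (int n) \<omega>) = g" for n
      using pgf_Y_eq[of n u] by (simp add: pgf_def g_def)
    have "expectation (\<lambda>\<omega>. X s \<omega> * X (s + h) \<omega>)
        = expectation (\<lambda>\<omega>. u ^ Y (int s) \<omega> * u ^ Y (int s + int h) \<omega>
            - g * u ^ Y (int s) \<omega> - g * u ^ Y (int (s + h)) \<omega> + g * g)"
      unfolding X_def by (rule Bochner_Integration.integral_cong) (auto simp: algebra_simps)
    also have "\<dots> = m h - g * g - g * g + g * g"
      using int int2 by (simp only: Bochner_Integration.integral_add Bochner_Integration.integral_diff
        Bochner_Integration.integrable_diff Bochner_Integration.integrable_add integrable_mult_right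
        integrable_const integral_mult_right_zero E prod lebesgue_integral_const prob_space scaleR_one)
    finally show ?thesis by (simp add: power2_eq_square)
  qed
  have second_moment: "(\<lambda>T. expectation (\<lambda>\<omega>. (emp_pgf Y T \<omega> u - g)\<^sup>2)) \<longlonglongrightarrow> 0"
  proof (rule order_tendstoI)
    fix a :: real assume "0 < a"
    \<comment> \<open>Half of \<open>a\<close> bounds the covariances beyond lag \<open>H\<close>;
      the gap between \<open>b\<close> and \<open>a\<close> absorbs the near-diagonal term once
      \<open>T\<close> is large.\<close>
    define b where "b = a / 2"
    have b: "0 < b" "b < a" using \<open>0 < a\<close> by (auto simp: b_def)
    obtain H where H: "\<And>h. h \<ge> H \<Longrightarrow> \<bar>m h - g\<^sup>2\<bar> < b"
      using LIMSEQ_D[OF m b(1)] by (auto simp: real_norm_def)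
    \<comment> \<open>Truncated subtraction only clips the band at its left end: a time outside it
      still differs from \<open>s\<close> by more than \<open>H\<close>. Inside the band the trivial
      bound 1 is used.\<close>
    have cov_near: "expectation (\<lambda>\<omega>. X s \<omega> * X t \<omega>) \<le> b + indicator {s - H..s + H} t" for s t
    proof (cases "t \<in> {s - H..s + H}")
      case True
      have "expectation (\<lambda>\<omega>. X s \<omega> * X t \<omega>) \<le> expectation (\<lambda>_. 1)"
      proof (rule integral_mono[OF int_XX])
        fix \<omega>
        have "\<bar>X s \<omega> * X t \<omega>\<bar> \<le> 1" unfolding abs_mult using X_le by (intro mult_le_one) auto
        then show "X s \<omega> * X t \<omega> \<le> 1" by simp
      qed simp
      then show ?thesis using True b by (simp add: prob_space)
    next
      case False
      then have "s + H < t \<or> t + H < s" by auto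
      then show ?thesis
      proof
        assume "s + H < t"
        then have "expectation (\<lambda>\<omega>. X s \<omega> * X t \<omega>) < b"
          using EX[of s "t - s"] H[of "t - s"] by (simp add: abs_less_iff)
        then show ?thesis using False by simp
      next
        assume "t + H < s"
        then have "expectation (\<lambda>\<omega>. X t \<omega> * X s \<omega>) < b"
          using EX[of t "s - t"] H[of "s - t"] by (simp add: abs_less_iff)
        then show ?thesis using False by (simp add: mult.commute)
      qed
    qed
    have bound: "expectation (\<lambda>\<omega>. (emp_pgf Y T \<omega> u - g)\<^sup>2) \<le> b + real (2 * H + 1) / real T"
      if "T \<ge> 1" for T
    proof -
      have emp: "emp_pgf Y T \<omega> u - g = 1 / real T * (\<Sum>t=1..T. X t \<omega>)" for \<omega>
        using that by (simp add: emp_pgf_def X_def sum_subtractf field_simps)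
      have "expectation (\<lambda>\<omega>. (emp_pgf Y T \<omega> u - g)\<^sup>2)
          = expectation (\<lambda>\<omega>. (1 / real T)\<^sup>2 * (\<Sum>s=1..T. \<Sum>t=1..T. X s \<omega> * X t \<omega>))"
        unfolding emp power_mult_distrib power2_eq_square[of "sum _ _"] sum_product ..
      also have "\<dots> = (1 / real T)\<^sup>2 * (\<Sum>s=1..T. \<Sum>t=1..T. expectation (\<lambda>\<omega>. X s \<omega> * X t \<omega>))"
        using int_XX by (simp add: Bochner_Integration.integral_sum)
      \<comment> \<open>Each row of the double sum meets the band in at most
        \<open>2 * H + 1\<close> places.\<close>
      also have "\<dots> \<le> (1 / real T)\<^sup>2 * (\<Sum>s=1..T. real T * b + real (2 * H + 1))"
      proof (intro mult_left_mono sum_mono)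
        fix s
        have "(\<Sum>t=1..T. expectation (\<lambda>\<omega>. X s \<omega> * X t \<omega>))
            \<le> (\<Sum>t=1..T. b + indicator {s - H..s + H} t)"
          by (intro sum_mono cov_near)
        also have "\<dots> = real T * b + real (card ({1..T} \<inter> {s - H..s + H}))"
        proof -
          have "sum (indicator B) A = real (card (A \<inter> B))" if "finite A" for A B :: "nat set"
            using that by (simp add: indicator_def of_bool_def sum.If_cases)
          then show ?thesis by (simp only: sum.distrib finite_atLeastAtMost) simp
        qed
        also have "card ({1..T} \<inter> {s - H..s + H}) \<le> card {s - H..s + H}"
          by (intro card_mono) auto
        also have "card {s - H..s + H} \<le> 2 * H + 1" by simp
        finally show "(\<Sum>t=1..T. expectation (\<lambda>\<omega>. X s \<omega> * X t \<omega>)) \<le> real T * b + real (2 * H + 1)"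
          by simp
      qed simp
      also have "\<dots> = b + real (2 * H + 1) / real T"
        using that by (simp add: field_simps power2_eq_square)
      finally show ?thesis .
    qed
    have "(\<lambda>T. b + real (2 * H + 1) / real T) \<longlonglongrightarrow> b + 0"
      by (intro tendsto_add tendsto_const lim_const_over_n)
    then have "eventually (\<lambda>T. b + real (2 * H + 1) / real T < a) sequentially"
      using b by (intro order_tendstoD(2)) auto
    then show "eventually (\<lambda>T. expectation (\<lambda>\<omega>. (emp_pgf Y T \<omega> u - g)\<^sup>2) < a) sequentially"
      using eventually_ge_at_top[of 1] by eventually_elim (use bound in force)
  next
    fix a :: real assume a: "a < 0"
    have "0 \<le> expectation (\<lambda>\<omega>. (emp_pgf Y T \<omega> u - g)\<^sup>2)" for T by simp
    then show "eventually (\<lambda>T. a < expectation (\<lambda>\<omega>. (emp_pgf Y T \<omega> u - g)\<^sup>2)) sequentially"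
      using a by (intro always_eventually allI) (rule less_le_trans)
  qed
  have rv_emp [measurable]: "(\<lambda>\<omega>. emp_pgf Y T \<omega> u) \<in> borel_measurable M" for T
    unfolding emp_pgf_def by measurable
  show ?thesis
    unfolding conv_in_prob_def g_def[symmetric]
  proof (intro allI impI)
    fix a :: real assume a: "0 < a"
    have "(\<lambda>T. expectation (\<lambda>\<omega>. (emp_pgf Y T \<omega> u - g)\<^sup>2) / a\<^sup>2) \<longlonglongrightarrow> 0 / a\<^sup>2"
      using a by (intro tendsto_divide second_moment tendsto_const) auto
    then have lim: "(\<lambda>T. expectation (\<lambda>\<omega>. (emp_pgf Y T \<omega> u - g)\<^sup>2) / a\<^sup>2) \<longlonglongrightarrow> 0" by simp
    have "prob {\<omega> \<in> space M. a < dist (emp_pgf Y T \<omega> u) g}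
        \<le> expectation (\<lambda>\<omega>. (emp_pgf Y T \<omega> u - g)\<^sup>2) / a\<^sup>2" for T
    proof -
      have "prob {\<omega> \<in> space M. a < dist (emp_pgf Y T \<omega> u) g}
          \<le> prob {\<omega> \<in> space M. a \<le> \<bar>emp_pgf Y T \<omega> u - g\<bar>}"
        by (intro finite_measure_mono) (auto simp: dist_real_def)
      also have "\<dots> \<le> expectation (\<lambda>\<omega>. (emp_pgf Y T \<omega> u - g)\<^sup>2) / a\<^sup>2"
      proof (rule second_moment_method[OF _ _ a])
        show "integrable M (\<lambda>\<omega>. (emp_pgf Y T \<omega> u - g)\<^sup>2)"
        proof (rule integrable_const_bound[where B = 1])
          have "\<bar>emp_pgf Y T \<omega> u - g\<bar> \<le> 1" for \<omega>
            using g01 emp_pgf_nonneg[OF u, of Y T \<omega>] emp_pgf_le_1[OF u, of Y T \<omega>] by linarith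
          then show "AE \<omega> in M. norm ((emp_pgf Y T \<omega> u - g)\<^sup>2) \<le> 1"
            by (auto simp: abs_square_le_1)
        qed measurable
      qed measurable
      finally show ?thesis .
    qed
    then show "(\<lambda>T. prob {\<omega> \<in> space M. a < dist (emp_pgf Y T \<omega> u) g}) \<longlonglongrightarrow> 0"
      by (intro tendsto_sandwich[OF _ _ tendsto_const lim]) auto
  qed
qed

text \<open>Lists carry the discrete sigma-algebra here, so every event described through an
  estimator evaluated at the sample becomes measurable.\<close>

lemma measurable_sample: "sample Y T \<in> M \<rightarrow>\<^sub>M count_space UNIV"
proof -
  have "(\<lambda>\<omega>. map (\<lambda>t. Y (int t) \<omega>) ts) \<in> M \<rightarrow>\<^sub>M count_space UNIV" for ts
  proof (induction ts)
    case (Cons t ts)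
    note [measurable] = Cons.IH
    show ?case by simp measurable
  qed simp
  then show ?thesis unfolding sample_def[abs_def] .
qed

end

section \<open>Deterministic estimates: uniform closeness and weighted integrals\<close>

text \<open>As in Polya's theorem, monotonicity of both functions and continuity of the limit upgrade
  closeness on a finite grid to uniform closeness.\<close>
lemma uniform_closeness_from_grid:
  fixes g :: "real \<Rightarrow> real"
  assumes cont: "continuous_on {0..1} g" and mono: "mono_on {0..1} g" and b: "0 < b"
  obtains n :: nat where "0 < n"
    and "\<And>f u. \<lbrakk>mono_on {0..1} f; \<And>i. i \<le> n \<Longrightarrow> \<bar>f (real i / real n) - g (real i / real n)\<bar> \<le> b;
           u \<in> {0..1}\<rbrakk> \<Longrightarrow> \<bar>f u - g u\<bar> \<le> 2 * b"
proof -
  have "uniformly_continuous_on {0..1} g"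
    using cont by (rule compact_uniformly_continuous) simp
  then obtain d where d: "0 < d"
    and gd: "\<And>x y. x \<in> {0..1} \<Longrightarrow> y \<in> {0..1} \<Longrightarrow> dist y x < d \<Longrightarrow> dist (g y) (g x) < b"
    unfolding uniformly_continuous_on_def using b by metis
  obtain n :: nat where n: "0 < n" "1 / real n < d"
    using d by (metis reals_Archimedean inverse_eq_divide zero_less_Suc)
  show thesis
  proof (rule that[OF n(1)])
    fix f :: "real \<Rightarrow> real" and u :: real
    assume f: "mono_on {0..1} f" and u: "u \<in> {0..1}"
      and grid: "\<And>i. i \<le> n \<Longrightarrow> \<bar>f (real i / real n) - g (real i / real n)\<bar> \<le> b"
    show "\<bar>f u - g u\<bar> \<le> 2 * b"
    \<comment> \<open>At \<open>u = 1\<close> the cell index below would be \<open>n\<close> and its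
      right end would leave the grid, so the last grid point is used directly.\<close>
    proof (cases "u = 1")
      case True
      then show ?thesis using grid[of n] n b by simp
    next
      case False
      define i where "i = nat \<lfloor>u * real n\<rfloor>"
      define x where "x = real i / real n"
      define y where "y = real (Suc i) / real n"
      have "0 \<le> u * real n" using u by simp
      then have i: "real i \<le> u * real n" "u * real n < real i + 1"
        unfolding i_def by linarith+
      have "u * real n < 1 * real n"
        using False u n by (intro mult_strict_right_mono) auto
      then have "i < n" using i by linarith
      then have xy: "x \<in> {0..1}" "y \<in> {0..1}" "x \<le> u" "u \<le> y" "dist y x < d"
        using i n by (auto simp: x_def y_def field_simps dist_real_def)
      have gxy: "g y - g x < b"
        using gd[OF xy(1,2,5)] by (simp add: dist_real_def)
      \<comment> \<open>\<open>f u\<close> lies between \<open>f x\<close> and \<open>f y\<close>,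
        each within \<open>b\<close> of \<open>g\<close>, and \<open>g\<close> varies by less than
        \<open>b\<close> on the cell from \<open>x\<close> to \<open>y\<close>; the two errors add
        up to \<open>2 * b\<close>.\<close>
      have "f x \<le> f u" "f u \<le> f y" "g x \<le> g u" "g u \<le> g y"
        using f mono xy u by (auto simp: mono_on_def)
      moreover have "\<bar>f x - g x\<bar> \<le> b" "\<bar>f y - g y\<bar> \<le> b"
        using grid[of i] grid[of "Suc i"] \<open>i < n\<close> by (simp_all add: x_def y_def)
      ultimately show ?thesis using gxy by linarith
    qed
  qed
qed

lemma integrable_bounded_mult:
  fixes f w :: "'a \<Rightarrow> real"
  assumes "integrable N w" "f \<in> borel_measurable N" "\<And>x. x \<in> space N \<Longrightarrow> \<bar>f x\<bar> \<le> B"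
  shows "integrable N (\<lambda>x. f x * w x)"
proof (rule Bochner_Integration.integrable_bound)
  show "integrable N (\<lambda>x. B * w x)" using assms(1) by simp
  show "(\<lambda>x. f x * w x) \<in> borel_measurable N" using assms(1,2) by measurable
  show "AE x in N. norm (f x * w x) \<le> norm (B * w x)"
  proof (rule AE_I2)
    fix x assume "x \<in> space N"
    then have "\<bar>f x\<bar> \<le> \<bar>B\<bar>" using assms(3)[of x] by linarith
    then show "norm (f x * w x) \<le> norm (B * w x)" by (simp add: abs_mult mult_right_mono)
  qed
qed

text \<open>Factor the difference of squares: \<open>f + g\<close> is at most 2 in absolute value.
  The majorant \<open>r\<close> is a function and not a constant, because the distance between two
  members of the parametric family is controlled only after integration.\<close>

lemma weighted_square_integral_diff:
  fixes f g r w :: "'a \<Rightarrow> real"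
  assumes w: "integrable N w" "\<And>x. x \<in> space N \<Longrightarrow> 0 \<le> w x"
    and f: "f \<in> borel_measurable N" "\<And>x. x \<in> space N \<Longrightarrow> \<bar>f x\<bar> \<le> 1"
    and g: "g \<in> borel_measurable N" "\<And>x. x \<in> space N \<Longrightarrow> \<bar>g x\<bar> \<le> 1"
    and r: "integrable N (\<lambda>x. r x * w x)" "\<And>x. x \<in> space N \<Longrightarrow> \<bar>f x - g x\<bar> \<le> r x"
  shows "\<bar>(\<integral>x. (f x)\<^sup>2 * w x \<partial>N) - (\<integral>x. (g x)\<^sup>2 * w x \<partial>N)\<bar> \<le> 2 * (\<integral>x. r x * w x \<partial>N)"
proof -
  have int: "integrable N (\<lambda>x. (f x)\<^sup>2 * w x)" "integrable N (\<lambda>x. (g x)\<^sup>2 * w x)"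
    using f g by (auto intro!: integrable_bounded_mult[OF w(1), of _ 1] simp: abs_square_le_1)
  have "\<bar>(\<integral>x. (f x)\<^sup>2 * w x \<partial>N) - (\<integral>x. (g x)\<^sup>2 * w x \<partial>N)\<bar>
      = \<bar>\<integral>x. (f x)\<^sup>2 * w x - (g x)\<^sup>2 * w x \<partial>N\<bar>"
    using int by simp
  also have "\<dots> \<le> (\<integral>x. \<bar>(f x)\<^sup>2 * w x - (g x)\<^sup>2 * w x\<bar> \<partial>N)"
    by (rule integral_abs_bound)
  also have "\<dots> \<le> (\<integral>x. 2 * (r x * w x) \<partial>N)"
  proof (rule integral_mono)
    fix x assume x: "x \<in> space N"
    have "\<bar>(f x)\<^sup>2 * w x - (g x)\<^sup>2 * w x\<bar> = \<bar>f x + g x\<bar> * \<bar>f x - g x\<bar> * w x"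
    proof -
      have "(f x)\<^sup>2 * w x - (g x)\<^sup>2 * w x = (f x + g x) * (f x - g x) * w x"
        by (simp add: power2_eq_square algebra_simps)
      then show ?thesis using w(2)[OF x] by (simp add: abs_mult)
    qed
    also have "\<dots> \<le> 2 * r x * w x"
      using f(2)[OF x] g(2)[OF x] r(2)[OF x] w(2)[OF x] by (intro mult_right_mono mult_mono) auto
    finally show "\<bar>(f x)\<^sup>2 * w x - (g x)\<^sup>2 * w x\<bar> \<le> 2 * (r x * w x)" by simp
  qed (use int r in auto)
  finally show ?thesis by simp
qed

text \<open>Continuity in \<open>\<theta>\<close> is given for each \<open>u\<close> separately. As
  PGFs lie in the unit interval, dominated convergence with majorant \<open>\<bar>w u\<bar>\<close>
  turns it into continuity of the integrated distance, which is 0 at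
  \<open>\<theta>\<^sub>A\<close>.\<close>

lemma weighted_pgf_distance_small:
  fixes w :: "real \<Rightarrow> real" and Q :: "real \<Rightarrow> nat pmf"
  assumes w: "integrable (lebesgue_on {0..1}) w" and A: "\<theta>\<^sub>A \<in> \<Theta>"
    and cont: "\<And>u. u \<in> {0..1} \<Longrightarrow> continuous_on \<Theta> (\<lambda>\<theta>. pgf (measure_pmf (Q \<theta>)) (\<lambda>n. n) u)"
    and b: "0 < b"
  obtains d where "0 < d"
    and "\<And>\<theta>. \<theta> \<in> \<Theta> \<Longrightarrow> dist \<theta> \<theta>\<^sub>A < d \<Longrightarrow>
      (\<integral>u. \<bar>pgf (measure_pmf (Q \<theta>)) (\<lambda>n. n) u - pgf (measure_pmf (Q \<theta>\<^sub>A)) (\<lambda>n. n) u\<bar> * w u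
         \<partial>lebesgue_on {0..1}) < b"
proof -
  define h where "h \<theta> = pgf (measure_pmf (Q \<theta>)) (\<lambda>n. n)" for \<theta>
  define F where "F \<theta> = (\<integral>u. \<bar>h \<theta> u - h \<theta>\<^sub>A u\<bar> * w u \<partial>lebesgue_on {0..1})" for \<theta>
  have h [measurable]: "h \<theta> \<in> borel_measurable (lebesgue_on {0..1})" for \<theta>
    unfolding h_def
    by (intro continuous_imp_measurable_on_sets_lebesgue measure_pmf.continuous_on_pgf) auto
  have h01: "0 \<le> h \<theta> u" "h \<theta> u \<le> 1" if "u \<in> {0..1}" for \<theta> u
    unfolding h_def using that by (auto intro!: measure_pmf.pgf_nonneg measure_pmf.pgf_le_1)
  note [measurable] = borel_measurable_integrable[OF w]
  have "continuous (at \<theta>\<^sub>A within \<Theta>) F"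
    unfolding continuous_within_sequentially
  proof (intro allI impI)
    fix x :: "nat \<Rightarrow> real" assume x: "(\<forall>n. x n \<in> \<Theta>) \<and> x \<longlonglongrightarrow> \<theta>\<^sub>A"
    show "(F \<circ> x) \<longlonglongrightarrow> F \<theta>\<^sub>A"
      unfolding F_def comp_def
    proof (rule integral_dominated_convergence[where w = "\<lambda>u. \<bar>w u\<bar>"])
      show "AE u in lebesgue_on {0..1}. (\<lambda>n. \<bar>h (x n) u - h \<theta>\<^sub>A u\<bar> * w u)
          \<longlonglongrightarrow> \<bar>h \<theta>\<^sub>A u - h \<theta>\<^sub>A u\<bar> * w u"
      proof (rule AE_I2)
        fix u :: real assume "u \<in> space (lebesgue_on {0..1})"
        then have "continuous_on \<Theta> (\<lambda>\<theta>. h \<theta> u)"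
          using cont[of u] by (simp add: h_def)
        then have "(\<lambda>n. h (x n) u) \<longlonglongrightarrow> h \<theta>\<^sub>A u"
          by (rule continuous_on_tendsto_compose) (use x A in auto)
        then show "(\<lambda>n. \<bar>h (x n) u - h \<theta>\<^sub>A u\<bar> * w u) \<longlonglongrightarrow> \<bar>h \<theta>\<^sub>A u - h \<theta>\<^sub>A u\<bar> * w u"
          by (intro tendsto_intros)
      qed
      show "AE u in lebesgue_on {0..1}. norm (\<bar>h (x n) u - h \<theta>\<^sub>A u\<bar> * w u) \<le> \<bar>w u\<bar>" for n
      proof (rule AE_I2)
        fix u :: real assume "u \<in> space (lebesgue_on {0..1})"
        then have "u \<in> {0..1}" by simp
        then have "\<bar>h (x n) u - h \<theta>\<^sub>A u\<bar> \<le> 1"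
          using h01[of u "x n"] h01[of u \<theta>\<^sub>A] by linarith
        then show "norm (\<bar>h (x n) u - h \<theta>\<^sub>A u\<bar> * w u) \<le> \<bar>w u\<bar>"
          by (simp add: abs_mult mult_left_le_one_le)
      qed
    qed (use w in auto)
  qed
  then obtain d where d: "0 < d" "\<And>\<theta>. \<theta> \<in> \<Theta> \<Longrightarrow> dist \<theta> \<theta>\<^sub>A < d \<Longrightarrow> dist (F \<theta>) (F \<theta>\<^sub>A) < b"
    unfolding continuous_within_eps_delta using b by metis
  have "F \<theta>\<^sub>A = 0" by (simp add: F_def)
  with d have "F \<theta> < b" if "\<theta> \<in> \<Theta>" "dist \<theta> \<theta>\<^sub>A < d" for \<theta>
    using d(2)[OF that] by (simp add: dist_real_def)
  with d(1) show thesis unfolding F_def h_def by (rule that)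
qed

section \<open>Convergence of the scaled test statistic\<close>

theorem theorem4p3:
  fixes M :: "'a measure" and p :: real
    and U :: "int \<Rightarrow> nat \<Rightarrow> 'a \<Rightarrow> nat" and \<epsilon> Y :: "int \<Rightarrow> 'a \<Rightarrow> nat"
    and \<Theta> :: "real set" and Q :: "real \<Rightarrow> nat pmf"
    and p_est \<theta>_est :: "nat list \<Rightarrow> real" and \<theta>\<^sub>A :: real
    and w v :: "real \<Rightarrow> real"
  assumes model: "inar1 M p U \<epsilon> Y"
    and open_Theta: "open \<Theta>"
    and est_in_Theta: "\<And>T \<omega>. T \<ge> 1 \<Longrightarrow> \<omega> \<in> space M \<Longrightarrow> \<theta>_est (sample Y T \<omega>) \<in> \<Theta>"
    and theta_A: "\<theta>\<^sub>A \<in> \<Theta>"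
    and est_conv: "conv_in_prob M (\<lambda>T \<omega>. (p_est (sample Y T \<omega>), \<theta>_est (sample Y T \<omega>))) (p, \<theta>\<^sub>A)"
    and w_nonneg: "\<And>u. u \<in> {0..1} \<Longrightarrow> w u \<ge> 0"
    and w_integrable: "integrable (lebesgue_on {0..1}) w"
    and w_pos: "0 < (\<integral>u. w u \<partial>lebesgue_on {0..1})"
    and v_meas: "v \<in> borel_measurable (lebesgue_on {0..1})"
    and wv_integrable: "integrable (lebesgue_on {0..1}) (\<lambda>u. w u * (v u)\<^sup>2)"
    and cont: "\<And>u. u \<in> {0..1} \<Longrightarrow>
                 continuous_on \<Theta> (\<lambda>\<theta>. pgf (measure_pmf (Q \<theta>)) (\<lambda>n. n) u)"
  shows "conv_in_prob M (\<lambda>T \<omega>. test_stat Q p_est \<theta>_est w Y T \<omega> / real T)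
           (\<integral>u. (pgf M (Y 0) (1 + p * (u - 1))
                  * (pgf M (\<epsilon> 0) u - pgf (measure_pmf (Q \<theta>\<^sub>A)) (\<lambda>n. n) u))\<^sup>2 * w u
              \<partial>lebesgue_on {0..1})"
proof -
  interpret inar1 M p U \<epsilon> Y by (rule model)
  define N :: "real measure" where "N = lebesgue_on {0..1}"
  define g where "g = pgf M (Y 0)"
  define h where "h \<theta> = pgf (measure_pmf (Q \<theta>)) (\<lambda>n. n)" for \<theta>
  define W where "W = (\<integral>u. w u \<partial>N)"
  have space_N: "space N = {0..1}" by (simp add: N_def)
  have W: "0 < W" using w_pos by (simp add: W_def N_def)
  have w_int: "integrable N w" using w_integrable by (simp add: N_def)
  have cont_meas: "f \<in> borel_measurable N" if "continuous_on {0..1} f" for f :: "real \<Rightarrow> real"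
    unfolding N_def using that by (rule continuous_imp_measurable_on_sets_lebesgue) simp
  have g_cont: "continuous_on {0..1} g" unfolding g_def by (rule continuous_on_pgf) simp
  have g_mono: "mono_on {0..1} g"
    unfolding g_def by (intro mono_onI pgf_mono) auto
  have g01: "0 \<le> g u" "g u \<le> 1" if "u \<in> {0..1}" for u
    unfolding g_def using that by (auto intro!: pgf_nonneg pgf_le_1)
  have h_cont: "continuous_on {0..1} (h \<theta>)" for \<theta>
    unfolding h_def by (rule measure_pmf.continuous_on_pgf) simp
  have h01: "0 \<le> h \<theta> u" "h \<theta> u \<le> 1" if "u \<in> {0..1}" for \<theta> u
    unfolding h_def using that by (auto intro!: measure_pmf.pgf_nonneg measure_pmf.pgf_le_1)
  have q_cont: "continuous_on {0..1} (\<lambda>u. k (1 + q * (u - 1)))"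
    if "continuous_on {0..1} k" "0 \<le> q" "q \<le> 1" for k :: "real \<Rightarrow> real" and q
    using that thinned_arg_in_unit[of q]
    by (intro continuous_on_compose2[OF that(1)] continuous_intros) blast+
  \<comment> \<open>By \<open>pgf_Y_fixed_point\<close> the claimed limit takes the shape of the
    statistic itself, with the empirical PGF and the estimates replaced by their limits.\<close>
  define c where "c = (\<integral>u. (g u - h \<theta>\<^sub>A u * g (1 + p * (u - 1)))\<^sup>2 * w u \<partial>N)"
  have limit_eq: "(\<integral>u. (pgf M (Y 0) (1 + p * (u - 1))
                  * (pgf M (\<epsilon> 0) u - pgf (measure_pmf (Q \<theta>\<^sub>A)) (\<lambda>n. n) u))\<^sup>2 * w u
              \<partial>lebesgue_on {0..1}) = c"
    unfolding c_def N_def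
    by (rule Bochner_Integration.integral_cong)
       (auto simp: g_def h_def pgf_Y_fixed_point algebra_simps)
  show ?thesis
    unfolding limit_eq conv_in_prob_def
  proof (intro allI impI)
    fix e :: real assume e: "0 < e"
    \<comment> \<open>The final error is at most \<open>2 * (5 * b * W + e / 5)\<close>. This choice
      gives \<open>20 * b * W \<le> e\<close>, so the total stays below
      \<open>e / 2 + 2 * e / 5\<close>.\<close>
    define b where "b = e / (20 * (W + 1))"
    have b: "0 < b" using e W by (simp add: b_def)
    obtain n where n: "0 < n"
      and grid: "\<And>f u. \<lbrakk>mono_on {0..1} f; \<And>i. i \<le> n \<Longrightarrow> \<bar>f (real i / real n) - g (real i / real n)\<bar> \<le> b;
           u \<in> {0..1}\<rbrakk> \<Longrightarrow> \<bar>f u - g u\<bar> \<le> 2 * b"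
      using uniform_closeness_from_grid[OF g_cont g_mono b] by metis
    have "uniformly_continuous_on {0..1} g"
      using g_cont by (rule compact_uniformly_continuous) simp
    then obtain d1 where d1: "0 < d1"
      and g_d1: "\<And>x y. x \<in> {0..1} \<Longrightarrow> y \<in> {0..1} \<Longrightarrow> dist y x < d1 \<Longrightarrow> dist (g y) (g x) < b"
      unfolding uniformly_continuous_on_def using b by metis
    obtain d2 where d2: "0 < d2"
      and h_d2: "\<And>\<theta>. \<theta> \<in> \<Theta> \<Longrightarrow> dist \<theta> \<theta>\<^sub>A < d2 \<Longrightarrow> (\<integral>u. \<bar>h \<theta> u - h \<theta>\<^sub>A u\<bar> * w u \<partial>N) < e / 5"
      unfolding h_def N_def
      by (rule weighted_pgf_distance_small[OF w_integrable theta_A cont, where b = "e / 5"])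
         (use e in auto)
    \<comment> \<open>Halving makes all comparisons strict. Staying below \<open>p\<close> and
      \<open>1 - p\<close> forces the estimate of \<open>p\<close> into the unit interval, so
      thinned arguments remain where the PGF bounds hold.\<close>
    define d where "d = min (min d1 d2) (min p (1 - p)) / 2"
    have d: "0 < d" "d < d1" "d < d2" "d < p" "d < 1 - p"
      using d1 d2 p unfolding d_def by (auto simp: min_def)
    define bad_est where "bad_est T =
      {\<omega> \<in> space M. d < dist (p_est (sample Y T \<omega>), \<theta>_est (sample Y T \<omega>)) (p, \<theta>\<^sub>A)}" for T
    define bad_emp where "bad_emp i T =
      {\<omega> \<in> space M. b < dist (emp_pgf Y T \<omega> (real i / real n)) (g (real i / real n))}" for i T
    have [measurable]: "bad_emp i T \<in> events" for i T
      unfolding bad_emp_def emp_pgf_def by measurable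
    have est_event: "bad_est T \<in> events" for T
    proof -
      have "bad_est T = sample Y T -` {x. d < dist (p_est x, \<theta>_est x) (p, \<theta>\<^sub>A)} \<inter> space M"
        by (auto simp: bad_est_def)
      then show ?thesis by (simp only:) (rule measurable_sets[OF measurable_sample], simp)
    qed
    \<comment> \<open>This estimate is deterministic. \<open>1 \<le> T\<close> serves to cancel the
      factor \<open>T\<close> in the statistic and to place the estimate of \<open>\<theta>\<close>
      in \<open>\<Theta>\<close>.\<close>
    have good: "dist (test_stat Q p_est \<theta>_est w Y T \<omega> / real T) c \<le> e"
      if T: "1 \<le> T" and \<omega>: "\<omega> \<in> space M" "\<omega> \<notin> bad_est T" "\<And>i. i \<le> n \<Longrightarrow> \<omega> \<notin> bad_emp i T" for T \<omega>
    proof -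
      define q where "q = p_est (sample Y T \<omega>)"
      define \<theta> where "\<theta> = \<theta>_est (sample Y T \<omega>)"
      define f where "f = emp_pgf Y T \<omega>"
      have "dist (q, \<theta>) (p, \<theta>\<^sub>A) \<le> d"
        using \<omega> by (auto simp: bad_est_def q_def \<theta>_def not_less)
      then have "dist q p \<le> d" "dist \<theta> \<theta>\<^sub>A \<le> d"
        using dist_fst_le[of "(q, \<theta>)" "(p, \<theta>\<^sub>A)"] dist_snd_le[of "(q, \<theta>)" "(p, \<theta>\<^sub>A)"] by auto
      then have q: "0 \<le> q" "q \<le> 1" "\<bar>q - p\<bar> < d1" and \<theta>: "dist \<theta> \<theta>\<^sub>A < d2"
        using d by (auto simp: dist_real_def)
      have \<theta>_in: "\<theta> \<in> \<Theta>" using est_in_Theta[OF T \<omega>(1)] by (simp add: \<theta>_def)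
      have f01: "0 \<le> f u" "f u \<le> 1" if "u \<in> {0..1}" for u
        using that by (auto simp: f_def emp_pgf_nonneg emp_pgf_le_1)
      have f_cont: "continuous_on {0..1} f" unfolding f_def by (rule continuous_on_emp_pgf)
      have fg: "\<bar>f u - g u\<bar> \<le> 2 * b" if "u \<in> {0..1}" for u
      proof (rule grid[OF _ _ that])
        show "mono_on {0..1} f" unfolding f_def by (intro mono_onI emp_pgf_mono) auto
        show "\<bar>f (real i / real n) - g (real i / real n)\<bar> \<le> b" if "i \<le> n" for i
          using \<omega>(1) \<omega>(3)[OF that] by (auto simp: bad_emp_def f_def dist_real_def not_less)
      qed
      define D where "D u = f u - h \<theta> u * f (1 + q * (u - 1))" for u
      define D0 where "D0 u = g u - h \<theta>\<^sub>A u * g (1 + p * (u - 1))" for u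
      \<comment> \<open>The budget \<open>5 * b\<close> consists of \<open>2 * b\<close> for
        \<open>f\<close> against \<open>g\<close> at \<open>u\<close>, \<open>2 * b\<close> for the
        same at the thinned argument, and \<open>b\<close> for moving the thinning parameter from
        \<open>q\<close> to \<open>p\<close> inside \<open>g\<close>.\<close>
      define r where "r u = 5 * b + \<bar>h \<theta> u - h \<theta>\<^sub>A u\<bar>" for u
      have qu: "1 + q * (u - 1) \<in> {0..1}" and pu: "1 + p * (u - 1) \<in> {0..1}"
        if "u \<in> {0..1}" for u
        using thinned_arg_in_unit[OF q(1,2) that] thinned_arg_in_unit[OF _ _ that, of p] p by auto
      have test: "test_stat Q p_est \<theta>_est w Y T \<omega> / real T = (\<integral>u. (D u)\<^sup>2 * w u \<partial>N)"
        using T by (simp add: test_stat_def null_pgf_def D_def f_def h_def q_def \<theta>_def N_def)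
      have c: "c = (\<integral>u. (D0 u)\<^sup>2 * w u \<partial>N)" by (simp add: c_def D0_def)
      have D_meas: "D \<in> borel_measurable N" unfolding D_def
        by (intro cont_meas continuous_on_diff continuous_on_mult f_cont h_cont q_cont q)
      have D0_meas: "D0 \<in> borel_measurable N" unfolding D0_def
        using p by (intro cont_meas continuous_on_diff continuous_on_mult g_cont h_cont q_cont) auto
      have h_int: "integrable N (\<lambda>u. \<bar>h \<theta> u - h \<theta>\<^sub>A u\<bar> * w u)"
      proof (rule integrable_bounded_mult[OF w_int])
        show "(\<lambda>u. \<bar>h \<theta> u - h \<theta>\<^sub>A u\<bar>) \<in> borel_measurable N"
          by (intro cont_meas continuous_intros h_cont)
        show "\<bar>\<bar>h \<theta> u - h \<theta>\<^sub>A u\<bar>\<bar> \<le> 1" if "u \<in> space N" for u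
          using that h01[of u \<theta>] h01[of u \<theta>\<^sub>A] by (auto simp: space_N)
      qed
      have "\<bar>(\<integral>u. (D u)\<^sup>2 * w u \<partial>N) - (\<integral>u. (D0 u)\<^sup>2 * w u \<partial>N)\<bar> \<le> 2 * (\<integral>u. r u * w u \<partial>N)"
      proof (rule weighted_square_integral_diff[OF w_int _ D_meas _ D0_meas])
        show "integrable N (\<lambda>u. r u * w u)"
          unfolding r_def using h_int w_int by (simp add: distrib_right)
      next
        fix u assume "u \<in> space N"
        then have u: "u \<in> {0..1}" by (simp add: space_N)
        show "0 \<le> w u" by (rule w_nonneg[OF u])
        have prod01: "0 \<le> x * y \<and> x * y \<le> 1" if "0 \<le> x" "x \<le> 1" "0 \<le> y" "y \<le> 1" for x y :: real
          using that by (auto intro: mult_le_one)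
        show "\<bar>D u\<bar> \<le> 1"
          using prod01[OF h01[OF u, of \<theta>] f01[OF qu[OF u]]] f01[OF u] unfolding D_def by linarith
        show "\<bar>D0 u\<bar> \<le> 1"
          using prod01[OF h01[OF u, of \<theta>\<^sub>A] g01[OF pu[OF u]]] g01[OF u] unfolding D0_def by linarith
        define x where "x = f (1 + q * (u - 1))"
        define y where "y = g (1 + p * (u - 1))"
        have y01: "0 \<le> y" "y \<le> 1" unfolding y_def using g01[OF pu[OF u]] by auto
        have "dist (1 + q * (u - 1)) (1 + p * (u - 1)) = \<bar>q - p\<bar> * \<bar>u - 1\<bar>"
          by (simp add: dist_real_def abs_mult[symmetric] algebra_simps)
        also have "\<dots> \<le> \<bar>q - p\<bar>" using u by (intro mult_left_le) auto
        finally have "dist (g (1 + q * (u - 1))) y < b"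
          unfolding y_def using q(3) by (intro g_d1 pu qu u) auto
        then have "\<bar>x - y\<bar> \<le> 3 * b"
          using fg[OF qu[OF u]] by (auto simp: x_def dist_real_def)
        moreover have "\<bar>h \<theta> u * (x - y)\<bar> \<le> \<bar>x - y\<bar>"
          using h01[OF u, of \<theta>] by (simp add: abs_mult mult_left_le_one_le)
        moreover have "\<bar>(h \<theta> u - h \<theta>\<^sub>A u) * y\<bar> \<le> \<bar>h \<theta> u - h \<theta>\<^sub>A u\<bar>"
          using y01 by (simp add: abs_mult mult_left_le)
        \<comment> \<open>The product is changed one factor at a time, and each remaining
          multiplier, \<open>h \<theta> u\<close> or \<open>y\<close>, lies in the unit
          interval.\<close>
        moreover have "D u - D0 u = (f u - g u) - h \<theta> u * (x - y) - (h \<theta> u - h \<theta>\<^sub>A u) * y"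
          by (simp add: D_def D0_def x_def y_def algebra_simps)
        ultimately show "\<bar>D u - D0 u\<bar> \<le> r u"
          using fg[OF u] unfolding r_def by linarith
      qed
      also have "(\<integral>u. r u * w u \<partial>N) = 5 * b * W + (\<integral>u. \<bar>h \<theta> u - h \<theta>\<^sub>A u\<bar> * w u \<partial>N)"
        unfolding r_def W_def distrib_right using h_int w_int by simp
      also have "2 * \<dots> \<le> 2 * (5 * b * W + e / 5)"
        using h_d2[OF \<theta>_in \<theta>] by simp
      also have "\<dots> \<le> e"
      proof -
        have "20 * b * W \<le> e" using W e by (simp add: b_def field_simps)
        then show ?thesis using e by simp
      qed
      finally show ?thesis by (simp add: test c dist_real_def)
    qed
    have "(\<lambda>T. prob (bad_est T) + (\<Sum>i\<le>n. prob (bad_emp i T))) \<longlonglongrightarrow> 0 + (\<Sum>i\<le>n. 0)"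
    proof (intro tendsto_add tendsto_sum)
      show "(\<lambda>T. prob (bad_est T)) \<longlonglongrightarrow> 0"
        using est_conv d(1) unfolding conv_in_prob_def bad_est_def by blast
      show "(\<lambda>T. prob (bad_emp i T)) \<longlonglongrightarrow> 0" if "i \<in> {..n}" for i
        using emp_pgf_conv_in_prob[of "real i / real n"] that n b
        unfolding conv_in_prob_def bad_emp_def g_def by simp
    qed
    then have lim: "(\<lambda>T. prob (bad_est T) + (\<Sum>i\<le>n. prob (bad_emp i T))) \<longlonglongrightarrow> 0" by simp
    have le: "prob {\<omega> \<in> space M. e < dist (test_stat Q p_est \<theta>_est w Y T \<omega> / real T) c}
        \<le> prob (bad_est T) + (\<Sum>i\<le>n. prob (bad_emp i T))" if "1 \<le> T" for T
    proof -
      \<comment> \<open>By \<open>good\<close>, a deviation beyond \<open>e\<close> forces one of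
        finitely many bad events, whose number does not depend on \<open>T\<close>; their union is
        measurable and serves as the larger set in the comparison.\<close>
      have "prob {\<omega> \<in> space M. e < dist (test_stat Q p_est \<theta>_est w Y T \<omega> / real T) c}
          \<le> prob (bad_est T \<union> (\<Union>i\<le>n. bad_emp i T))"
        using good[OF that] est_event by (intro finite_measure_mono) (force simp: not_le[symmetric])+
      also have "\<dots> \<le> prob (bad_est T) + prob (\<Union>i\<le>n. bad_emp i T)"
        using est_event by (intro measure_Un_le) auto
      also have "prob (\<Union>i\<le>n. bad_emp i T) \<le> (\<Sum>i\<le>n. prob (bad_emp i T))"
        by (intro finite_measure_subadditive_finite) auto
      finally show ?thesis by simp
    qed
    show "(\<lambda>T. prob {\<omega> \<in> space M. e < dist (test_stat Q p_est \<theta>_est w Y T \<omega> / real T) c}) \<longlonglongrightarrow> 0"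
    proof (rule tendsto_sandwich[OF _ _ tendsto_const lim])
      show "\<forall>\<^sub>F T in sequentially. prob {\<omega> \<in> space M. e < dist (test_stat Q p_est \<theta>_est w Y T \<omega> / real T) c}
          \<le> prob (bad_est T) + (\<Sum>i\<le>n. prob (bad_emp i T))"
        using eventually_ge_at_top[of 1] by eventually_elim (rule le)
    qed simp
  qed
qed

end
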